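(* Let $E\subset\mathbb{R}^d$ be the non-autonomous attractor determined by a collection $\mathcal{J}=\{J_{\mathbf u}:\mathbf u\in\Sigma^*\}$ fulfilling the non-autonomous structure with respect to $\{\Xi_k\}_{k\ge1}$, $\Xi_k=\{S_{k,1},\dots,S_{k,n_k}\}$ (see context). Assume that for every integer $k\ge 1$ and every $i=1,\dots,n_k$ there is a number $0<c_{k,i}<1$ with $$|S_{k,i}(x)-S_{k,i}(y)|\le c_{k,i}|x-y|\qquad (x,y\in J).$$ For each $k\geq 1$ let $d_k$ be the unique real solution of $\prod_{i=1}^{k}\big(\sum_{j=1}^{n_i}(c_{i,j})^{d_k}\big)=1$, and put $d_*=\liminf_{k\to\infty}d_k$, $d^*=\limsup_{k\to\infty}d_k$. Then $$\dim_{\rm H}E\le\min\{d_*,d\}.$$ Furthermore, if $c_*=\inf\{c_{k,j}:k\in\mathbb{N},1\le j\le n_k\}>0$, then $$\overline{\dim}_{\rm B}E\le\min\{d^*,d\}.$$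
   Context: Let $\{n_k\}_{k\ge1}$ be integers with $n_k\ge2$. Put $\Sigma^k=\{u_1u_2\cdots u_k:1\le u_j\le n_j,\ j\le k\}$, $\Sigma^0=\{\emptyset\}$ (the empty word) and $\Sigma^*=\bigcup_{k\ge0}\Sigma^k$. Let $J\subset\mathbb{R}^d$ be a compact set with non-empty interior. For each $k\ge1$ let $\Xi_k=\{S_{k,1},\dots,S_{k,n_k}\}$ be a collection of contractive mappings of $\mathbb{R}^d$ (each is Lipschitz with some constant in $(0,1)$). A collection $\mathcal{J}=\{J_{\mathbf u}:\mathbf u\in\Sigma^*\}$ of closed subsets of $J$ fulfils the non-autonomous structure with respect to $\{\Xi_k\}$ if: (1) $J_\emptyset=J$, and for all $k\ge1$ and $\mathbf u\in\Sigma^{k-1}$ the sets $J_{\mathbf u1},\dots,J_{\mathbf un_k}$ are subsets of $J_{\mathbf u}$; (2) there are vectors $\omega_{\mathbf v}\in\mathbb{R}^d$ ($\mathbf v\in\Sigma^*\setminus\{\emptyset\}$) such that for each $\mathbf u=u_1\cdots u_k\in\Sigma^*$, $J_{\mathbf u}=\Psi_{\mathbf u}(J)=\Psi_{u_1}\circ\cdots\circ\Psi_{u_k}(J)$, where $\Psi_{u_j}(x)=S_{j,u_j}(x)+\omega_{u_1\cdots u_j}$, $j=1,\dots,k$; (3) $\lim_{k\to\infty}\max_{\mathbf u\in\Sigma^k}|J_{\mathbf u}|=0$, where $|\cdot|$ of a set denotes its diameter. The non-autonomous attractor determined by $\mathcal{J}$ is the non-empty compact set $E=\bigcap_{k=1}^\infty\bigcup_{\mathbf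 u\in\Sigma^k}J_{\mathbf u}$. $\dim_{\rm H}$ and $\overline{\dim}_{\rm B}$ denote Hausdorff and upper box-counting dimension.
   Formalization: The bound with c_{j,u_j} for S_{j,u_j} is also assumed on Ψ_{u_{j+1}}∘⋯∘Ψ_{u_k}(J) for j<k, not only on J; otherwise the claim fails for non-injective maps. This is automatic if the S_{k,i} are injective or the c_{k,i} are Lipschitz constants on R^d. *)

theory Defs
  imports "HOL-Analysis.Analysis"
begin

section \<open>Words\<close>

text \<open>Letters and levels start at 1, so the letter \<open>u\<^sub>j\<close> of a word is \<open>u ! (j - 1)\<close>;
  the value \<open>n 0\<close> is never used.\<close>

definition words :: "(nat \<Rightarrow> nat) \<Rightarrow> nat \<Rightarrow> nat list set" where
  "words n k = {u. length u = k \<and> (\<forall>j\<in>{1..k}. u ! (j - 1) \<in> {1..n j})}"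

definition all_words :: "(nat \<Rightarrow> nat) \<Rightarrow> nat list set" where
  "all_words n = (\<Union>k. words n k)"

section \<open>The non-autonomous structure\<close>

text \<open>For a non-empty word \<open>v = u\<^sub>1\<dots>u\<^sub>j\<close> this is the map written \<open>\<Psi>\<close> with index \<open>u\<^sub>j\<close>;
  because of the translation it depends on the whole prefix \<open>v\<close>.\<close>

definition psi ::
    "(nat \<Rightarrow> nat \<Rightarrow> 'a \<Rightarrow> 'a) \<Rightarrow> (nat list \<Rightarrow> 'a) \<Rightarrow> nat list \<Rightarrow> 'a \<Rightarrow> 'a::euclidean_space" where
  "psi S \<omega> v x = S (length v) (last v) x + \<omega> v"

text \<open>For \<open>u = u\<^sub>1\<dots>u\<^sub>k\<close>, \<open>psi_comp S \<omega> u m\<close> is the composition of the maps of the prefixes of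
  lengths \<open>m + 1, \<dots>, k\<close>, the one of length \<open>k\<close> being applied first. The whole map of \<open>u\<close> is
  \<open>psi_comp S \<omega> u 0\<close>, and \<open>psi_comp S \<omega> u k\<close> is the identity.\<close>

definition psi_comp ::
    "(nat \<Rightarrow> nat \<Rightarrow> 'a \<Rightarrow> 'a) \<Rightarrow> (nat list \<Rightarrow> 'a) \<Rightarrow> nat list \<Rightarrow> nat \<Rightarrow> 'a \<Rightarrow> 'a::euclidean_space" where
  "psi_comp S \<omega> u m = foldr (\<circ>) (map (\<lambda>j. psi S \<omega> (take j u)) [Suc m..<Suc (length u)]) id"

definition nonautonomous_structure ::
    "(nat \<Rightarrow> nat) \<Rightarrow> (nat \<Rightarrow> nat \<Rightarrow> 'a \<Rightarrow> 'a) \<Rightarrow> 'a set \<Rightarrow> (nat list \<Rightarrow> 'a)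
      \<Rightarrow> (nat list \<Rightarrow> 'a::euclidean_space set) \<Rightarrow> bool" where
  "nonautonomous_structure n S J \<omega> JJ \<longleftrightarrow>
     (\<forall>u\<in>all_words n. closed (JJ u) \<and> JJ u \<subseteq> J) \<and>
     JJ [] = J \<and>
     (\<forall>k\<ge>1. \<forall>u\<in>words n (k - 1). \<forall>i\<in>{1..n k}. JJ (u @ [i]) \<subseteq> JJ u) \<and>
     (\<forall>u\<in>all_words n. JJ u = psi_comp S \<omega> u 0 ` J) \<and>
     (\<lambda>k. Max ((\<lambda>u. diameter (JJ u)) ` words n k)) \<longlonglongrightarrow> 0"

definition attractor :: "(nat \<Rightarrow> nat) \<Rightarrow> (nat list \<Rightarrow> 'a set) \<Rightarrow> 'a set" where
  "attractor n JJ = (\<Inter>k\<in>{1..}. \<Union>u\<in>words n k. JJ u)"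

text \<open>Bounding the diameter of \<open>JJ u\<close> by a product of Lipschitz constants evaluates the map of
  level \<open>j\<close> at points of \<open>psi_comp S \<omega> u j ` J\<close>. If the maps are injective on the whole space
  then these points lie in \<open>J\<close>, so that Lipschitz constants on \<open>J\<close> suffice. Without
  injectivity they may lie outside \<open>J\<close>, where the Lipschitz constants on \<open>J\<close> need not be
  valid, and then the dimension estimates can fail.\<close>

lemma foldr_comp_append:
  "foldr (\<circ>) (fs @ gs) id = foldr (\<circ>) fs id \<circ> foldr (\<circ>) gs id"
  by (induction fs) (simp_all add: comp_assoc)

lemma take_words: "u \<in> words n k \<Longrightarrow> j \<le> k \<Longrightarrow> take j u \<in> words n j"
  by (auto simp: words_def)

lemma psi_comp_split:
  assumes "j \<le> length u"
  shows "psi_comp S \<omega> u 0 = psi_comp S \<omega> (take j u) 0 \<circ> psi_comp S \<omega> u j"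
proof -
  have "[Suc 0..<Suc (length u)] = [Suc 0..<Suc j] @ [Suc j..<Suc (length u)]"
    using assms upt_add_eq_append[of "Suc 0" "Suc j" "length u - j"] by simp
  then have "psi_comp S \<omega> u 0 =
      foldr (\<circ>) (map (\<lambda>i. psi S \<omega> (take i u)) [Suc 0..<Suc j]) id \<circ> psi_comp S \<omega> u j"
    unfolding psi_comp_def by (simp only: map_append foldr_comp_append)
  also have "map (\<lambda>i. psi S \<omega> (take i u)) [Suc 0..<Suc j] =
      map (\<lambda>i. psi S \<omega> (take i (take j u))) [Suc 0..<Suc (length (take j u))]"
    using assms by (intro map_cong) (auto simp: min_absorb1 min_absorb2)
  finally show ?thesis
    unfolding psi_comp_def .
qed

lemma inj_psi_comp:
  assumes "u \<in> words n k" and "\<And>k i. k \<ge> 1 \<Longrightarrow> i \<in> {1..n k} \<Longrightarrow> inj (S k i)"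
  shows "inj (psi_comp S \<omega> u 0)"
proof -
  have fold: "inj (foldr (\<circ>) fs id)" if "\<forall>f\<in>set fs. inj f" for fs :: "('a \<Rightarrow> 'a) list"
    using that
  proof (induction fs)
    case (Cons f fs)
    then have f: "inj f" "\<forall>g\<in>set fs. inj g" by simp_all
    have "foldr (\<circ>) (f # fs) id = f \<circ> foldr (\<circ>) fs id"
      by (simp only: foldr_Cons comp_apply)
    then show ?case
      using inj_compose[OF f(1) Cons.IH[OF f(2)]] by metis
  qed simp
  have "inj (psi S \<omega> (take j u))" if "1 \<le> j" "j \<le> k" for j
  proof -
    have u: "length u = k" "u ! (j - 1) \<in> {1..n j}"
      using assms(1) that by (auto simp: words_def)
    have "take j u \<noteq> []" using u that by auto
    then have "last (take j u) = u ! (j - 1)"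
      using u that by (simp add: last_conv_nth min_def)
    then have "psi S \<omega> (take j u) = (\<lambda>x. S j (u ! (j - 1)) x + \<omega> (take j u))"
      using u(1) that(2) by (intro ext) (simp only: psi_def length_take min_absorb2)
    then show ?thesis
      using injD[OF assms(2)[OF that(1) u(2)]] by (intro injI) (simp only: add_right_cancel)
  qed
  then have "\<forall>f\<in>set (map (\<lambda>j. psi S \<omega> (take j u)) [Suc 0..<Suc (length u)]). inj f"
    using assms(1) by (simp only: words_def list.set_map) force
  then show ?thesis
    unfolding psi_comp_def by (rule fold)
qed

lemma psi_comp_image_subset_if_inj:
  assumes str: "nonautonomous_structure n S J \<omega> JJ"
    and inj: "\<And>k i. k \<ge> 1 \<Longrightarrow> i \<in> {1..n k} \<Longrightarrow> inj (S k i)"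
    and u: "u \<in> words n k" and j: "j \<le> k"
  shows "psi_comp S \<omega> u j ` J \<subseteq> J"
proof -
  have len: "length u = k" using u by (simp add: words_def)
  have step1: "JJ (w @ [i]) \<subseteq> JJ w" if "w \<in> words n m" "i \<in> {1..n (Suc m)}" for w m i
  proof -
    have "\<forall>k\<ge>1. \<forall>u\<in>words n (k - 1). \<forall>i\<in>{1..n k}. JJ (u @ [i]) \<subseteq> JJ u"
      using str unfolding nonautonomous_structure_def by blast
    from this[rule_format, of "Suc m" w i] that show ?thesis by simp
  qed
  have sub: "JJ (take m u) \<subseteq> JJ (take j u)" if "j \<le> m" "m \<le> k" for m
    using that
  proof (induction rule: dec_induct)
    case (step m)
    have "\<forall>i\<in>{1..k}. u ! (i - 1) \<in> {1..n i}" using u by (simp add: words_def)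
    from this[rule_format, of "Suc m"] step have "u ! m \<in> {1..n (Suc m)}" by simp
    moreover have "take m u \<in> words n m" using take_words[OF u] step by simp
    ultimately have "JJ (take m u @ [u ! m]) \<subseteq> JJ (take m u)"
      using step1 by blast
    then show ?case
      using step len by (simp add: take_Suc_conv_app_nth)
  qed simp
  have tj: "take j u \<in> words n j" using take_words[OF u j] .
  have im: "JJ w = psi_comp S \<omega> w 0 ` J" if "w \<in> words n m" for w m
    using str that unfolding nonautonomous_structure_def all_words_def by blast
  have "psi_comp S \<omega> (take j u) 0 ` (psi_comp S \<omega> u j ` J) \<subseteq> psi_comp S \<omega> (take j u) 0 ` J"
    using sub[of k] j len im[OF u] im[OF tj] psi_comp_split[of j u S \<omega>]
    by (simp add: image_comp)
  then show ?thesis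
    using inj_psi_comp[OF tj inj] by (simp add: inj_image_subset_iff)
qed

section \<open>The critical exponents\<close>

definition critical_exponent :: "(nat \<Rightarrow> nat) \<Rightarrow> (nat \<Rightarrow> nat \<Rightarrow> real) \<Rightarrow> nat \<Rightarrow> real" where
  "critical_exponent n c k = (THE t. (\<Prod>i = 1..k. \<Sum>j = 1..n i. c i j powr t) = 1)"

section \<open>Hausdorff and upper box-counting dimension\<close>

text \<open>The \<open>s\<close>-th power of the diameter of \<open>U\<close>, with the usual conventions that the empty set
  contributes 0 and that every non-empty set contributes 1 when \<open>s = 0\<close> (whereas
  \<open>0 powr 0 = 0\<close>). Only used for bounded sets.\<close>

definition diam_pow :: "real \<Rightarrow> 'a::metric_space set \<Rightarrow> ennreal" where
  "diam_pow s U = (if U = {} then 0 else if s = 0 then 1 else ennreal (diameter U powr s))"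

definition hausdorff_content :: "real \<Rightarrow> real \<Rightarrow> 'a::metric_space set \<Rightarrow> ennreal" where
  "hausdorff_content s \<delta> E =
     (INF U \<in> {U :: nat \<Rightarrow> 'a set. E \<subseteq> (\<Union>i. U i) \<and> (\<forall>i. bounded (U i) \<and> diameter (U i) \<le> \<delta>)}.
        \<Sum>i. diam_pow s (U i))"

definition hausdorff_measure :: "real \<Rightarrow> 'a::metric_space set \<Rightarrow> ennreal" where
  "hausdorff_measure s E = (SUP \<delta> \<in> {0<..}. hausdorff_content s \<delta> E)"

definition hausdorff_dim :: "'a::metric_space set \<Rightarrow> ereal" where
  "hausdorff_dim E = (INF s \<in> {s. 0 \<le> s \<and> hausdorff_measure s E = 0}. ereal s)"

text \<open>The least number of sets of diameter at most \<open>\<delta>\<close> that cover \<open>E\<close>. This and the upper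
  box-counting dimension are meaningful for non-empty bounded subsets of a Euclidean space.\<close>

definition box_count :: "real \<Rightarrow> 'a::metric_space set \<Rightarrow> nat" where
  "box_count \<delta> E = (LEAST m. \<exists>F. finite F \<and> card F = m \<and> E \<subseteq> \<Union>F \<and>
     (\<forall>U\<in>F. bounded U \<and> diameter U \<le> \<delta>))"

definition upper_box_dim :: "'a::metric_space set \<Rightarrow> ereal" where
  "upper_box_dim E =
     Limsup (at_right 0) (\<lambda>\<delta>. ereal (ln (real (box_count \<delta> E)) / - ln \<delta>))"

end

theory Submission
  imports Defs
begin

text \<open>The Lipschitz conditions bound the diameter of \<open>JJ u\<close> by a constant times the product
  \<open>weight c u\<close> of the ratios along \<open>u\<close>. The sum of \<open>weight c u powr s\<close> over the words of length
  \<open>k\<close> factorises over the levels, and it is at most 1 if \<open>s\<close> exceeds the critical exponent of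
  level \<open>k\<close>. If this happens for infinitely many \<open>k\<close>, the covers by these levels bound the Hausdorff
  measure.

  If it happens for all large \<open>k\<close> and the ratios are bounded below by \<open>a > 0\<close>, stop each
  infinite word at the first time its weight is at most \<open>\<delta>\<close>. Normalising \<open>weight c u powr s\<close>
  by the sum over the level of \<open>u\<close> gives a probability measure on infinite words. As these sums
  are at most 1, the stopped words \<open>u\<close> satisfy \<open>(\<Sum>u. weight c u powr s) \<le> 1\<close>. Each of
  them has weight at least \<open>a * \<delta>\<close>, so their number is at most \<open>(a * \<delta>) powr (- s)\<close>.\<close>

section \<open>Dimension bounds from finite covers\<close>

text \<open>The content is an infimum over sequences of sets, so the finite family is enumerated and
  padded with empty sets, which contribute 0.\<close>

lemma hausdorff_content_le_finite_cover:
  fixes E :: "'a::metric_space set"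
  assumes "finite F" "E \<subseteq> \<Union>F" "0 \<le> \<delta>" "0 < t"
    and F: "\<And>U. U \<in> F \<Longrightarrow> bounded U \<and> diameter U \<le> \<delta>"
  shows "hausdorff_content t \<delta> E \<le> ennreal (\<Sum>U\<in>F. diameter U powr t)"
proof -
  obtain f where f: "bij_betw f {0..<card F} F"
    using ex_bij_betw_nat_finite[OF \<open>finite F\<close>] by blast
  define V where "V i = (if i < card F then f i else {})" for i
  have fF: "f i \<in> F" if "i < card F" for i
    using f that by (auto simp: bij_betw_def)
  have "E \<subseteq> (\<Union>i. V i)"
  proof
    fix x assume "x \<in> E"
    then obtain U where U: "U \<in> F" "x \<in> U" using assms(2) by blast
    then have "U \<in> f ` {0..<card F}" using f by (simp add: bij_betw_def)
    then obtain i where "i < card F" "f i = U" by auto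
    with U show "x \<in> (\<Union>i. V i)" by (auto simp: V_def intro!: exI[of _ i])
  qed
  moreover have "bounded (V i) \<and> diameter (V i) \<le> \<delta>" for i
    using F[OF fF] \<open>0 \<le> \<delta>\<close> by (simp add: V_def)
  ultimately have "hausdorff_content t \<delta> E \<le> (\<Sum>i. diam_pow t (V i))"
    unfolding hausdorff_content_def by (intro INF_lower) auto
  also have "\<dots> = (\<Sum>i<card F. diam_pow t (V i))"
    by (rule suminf_finite) (auto simp: V_def diam_pow_def)
  also have "\<dots> = (\<Sum>i<card F. ennreal (diameter (f i) powr t))"
    using \<open>0 < t\<close> by (intro sum.cong) (auto simp: V_def diam_pow_def)
  also have "\<dots> = ennreal (\<Sum>i<card F. diameter (f i) powr t)"
    by (simp add: sum_ennreal)
  also have "(\<Sum>i<card F. diameter (f i) powr t) = (\<Sum>U\<in>F. diameter U powr t)"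
    using sum.reindex_bij_betw[OF f, of "\<lambda>U. diameter U powr t"] by (simp add: lessThan_atLeast0)
  finally show ?thesis .
qed

text \<open>For \<open>t > s\<close>, a set of diameter at most \<eta> satisfies \<open>diameter U
  powr t \<le> \<eta> powr (t - s) * diameter U powr s\<close>. The bound \<open>C\<close> on the
  sums of \<open>s\<close>-th powers therefore makes the \<open>t\<close>-dimensional measure vanish
  as \<eta> tends to 0, for every \<open>t > s\<close>.\<close>

lemma hausdorff_dim_le:
  fixes E :: "'a::metric_space set"
  assumes "0 \<le> s"
    and cover: "\<And>\<delta>. 0 < \<delta> \<Longrightarrow> \<exists>F. finite F \<and> E \<subseteq> \<Union>F \<and>
      (\<forall>U\<in>F. bounded U \<and> diameter U \<le> \<delta>) \<and> (\<Sum>U\<in>F. diameter U powr s) \<le> C"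
  shows "hausdorff_dim E \<le> ereal s"
proof -
  have zero: "hausdorff_measure t E = 0" if "s < t" for t
  proof -
    have "0 < t" using that \<open>0 \<le> s\<close> by simp
    \<comment> \<open>A cover at a finer scale \<eta> is also admissible at scale \<delta>; so
      \<delta> stays fixed while \<eta> tends to 0.\<close>
    have small: "hausdorff_content t \<delta> E \<le> ennreal (\<eta> powr (t - s) * C)"
      if "0 < \<eta>" "\<eta> \<le> \<delta>" for \<eta> \<delta>
    proof -
      obtain F where F: "finite F" "E \<subseteq> \<Union>F" "\<And>U. U \<in> F \<Longrightarrow> bounded U \<and> diameter U \<le> \<eta>"
        "(\<Sum>U\<in>F. diameter U powr s) \<le> C"
        using cover[OF \<open>0 < \<eta>\<close>] by blast
      have "hausdorff_content t \<delta> E \<le> ennreal (\<Sum>U\<in>F. diameter U powr t)"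
        using F(1,2) that \<open>0 < t\<close> order_trans[OF conjunct2[OF F(3)] \<open>\<eta> \<le> \<delta>\<close>] F(3)
        by (intro hausdorff_content_le_finite_cover) auto
      also have "(\<Sum>U\<in>F. diameter U powr t) \<le> (\<Sum>U\<in>F. \<eta> powr (t - s) * diameter U powr s)"
      proof (intro sum_mono)
        fix U assume "U \<in> F"
        have "diameter U powr t = diameter U powr (t - s) * diameter U powr s"
          by (simp flip: powr_add)
        also have "\<dots> \<le> \<eta> powr (t - s) * diameter U powr s"
          using F(3)[OF \<open>U \<in> F\<close>] \<open>s < t\<close>
          by (intro mult_right_mono powr_mono2) (auto simp: diameter_ge_0)
        finally show "diameter U powr t \<le> \<eta> powr (t - s) * diameter U powr s" .
      qed
      also have "\<dots> = \<eta> powr (t - s) * (\<Sum>U\<in>F. diameter U powr s)"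
        by (simp add: sum_distrib_left)
      also have "\<dots> \<le> \<eta> powr (t - s) * C"
        using F(4) by (intro mult_left_mono) auto
      finally show ?thesis by (simp add: ennreal_leI)
    qed
    have "hausdorff_content t \<delta> E = 0" if "0 < \<delta>" for \<delta>
    proof -
      have "((\<lambda>\<eta>. \<eta> powr (t - s) * C) \<longlongrightarrow> 0 powr (t - s) * C) (at_right 0)"
        using \<open>s < t\<close>
        by (intro tendsto_mult tendsto_powr' tendsto_const tendsto_ident_at)
           (auto simp: eventually_at_right_less eventually_at_filter)
      then have "((\<lambda>\<eta>. ennreal (\<eta> powr (t - s) * C)) \<longlongrightarrow> ennreal 0) (at_right 0)"
        by (intro tendsto_ennrealI) simp
      moreover have "\<forall>\<^sub>F \<eta> in at_right 0. hausdorff_content t \<delta> E \<le> ennreal (\<eta> powr (t - s) * C)"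
        using eventually_at_right_real[OF that] by eventually_elim (auto intro!: small)
      ultimately have "hausdorff_content t \<delta> E \<le> ennreal 0"
        by (intro tendsto_lowerbound) auto
      then show ?thesis by simp
    qed
    then show ?thesis
      unfolding hausdorff_measure_def by (intro antisym SUP_least) auto
  qed
  show ?thesis
  proof (rule ereal_le_epsilon2)
    fix e :: real assume "0 < e"
    then have "hausdorff_dim E \<le> ereal (s + e)"
      unfolding hausdorff_dim_def using zero[of "s + e"] \<open>0 \<le> s\<close> by (intro INF_lower) auto
    then show "hausdorff_dim E \<le> ereal s + ereal e" by simp
  qed
qed

lemma box_count_le_card:
  assumes "finite F" "E \<subseteq> \<Union>F" "\<And>U. U \<in> F \<Longrightarrow> bounded U \<and> diameter U \<le> \<delta>"
  shows "box_count \<delta> E \<le> card F"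
  unfolding box_count_def using assms by (intro Least_le) blast

text \<open>After taking logarithms the constant contributes only
  \<open>ln C' / - ln \<delta>\<close>, which tends to 0.\<close>

lemma upper_box_dim_le:
  assumes "0 \<le> s"
    and "\<forall>\<^sub>F \<delta> in at_right 0. real (box_count \<delta> E) \<le> C * \<delta> powr (-s)"
  shows "upper_box_dim E \<le> ereal s"
proof -
  \<comment> \<open>Raising the constant to at least 1 keeps the logarithm of the bound nonnegative.
    This covers the case \<open>box_count \<delta> E = 0\<close>, where \<open>ln 0 = 0\<close> by
    convention.\<close>
  define C' where "C' = max C 1"
  have "\<forall>\<^sub>F \<delta> in at_right 0. ereal (ln (real (box_count \<delta> E)) / - ln \<delta>) \<le> ereal (ln C' / - ln \<delta> + s)"
    using assms(2) eventually_at_right_real[OF zero_less_one]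
  proof eventually_elim
    case (elim \<delta>)
    then have \<delta>: "0 < \<delta>" "\<delta> < 1" by auto
    have "1 \<le> \<delta> powr (-s)"
      using \<delta> \<open>0 \<le> s\<close> powr_mono'[of "-s" 0 \<delta>] by simp
    then have ge1: "1 \<le> C' * \<delta> powr (-s)"
      using mult_mono[of 1 C' 1 "\<delta> powr (-s)"] by (simp add: C'_def)
    have "C * \<delta> powr (-s) \<le> C' * \<delta> powr (-s)"
      by (intro mult_right_mono) (auto simp: C'_def)
    then have le: "real (box_count \<delta> E) \<le> C' * \<delta> powr (-s)" using elim(1) by simp
    have "ln (real (box_count \<delta> E)) \<le> ln (C' * \<delta> powr (-s))"
    proof (cases "box_count \<delta> E = 0")
      case True
      then show ?thesis using ge1 by simp
    next
      case False
      then show ?thesis using le by (subst ln_le_cancel_iff) (auto intro: less_le_trans)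
    qed
    also have "\<dots> = ln C' + s * - ln \<delta>"
      using \<delta> by (subst ln_mult) (auto simp: C'_def ln_powr)
    finally have "ln (real (box_count \<delta> E)) / - ln \<delta> \<le> (ln C' + s * - ln \<delta>) / - ln \<delta>"
      using \<delta> by (intro divide_right_mono) auto
    also have "\<dots> = ln C' / - ln \<delta> + s"
      using \<delta> by (simp add: field_simps)
    finally show ?case by simp
  qed
  then have "upper_box_dim E \<le> Limsup (at_right 0) (\<lambda>\<delta>. ereal (ln C' / - ln \<delta> + s))"
    unfolding upper_box_dim_def by (rule Limsup_mono)
  also have "\<dots> = ereal s"
  proof (rule lim_imp_Limsup)
    have "filterlim (\<lambda>\<delta>::real. - ln \<delta>) at_top (at_right 0)"
      using ln_at_0 by (simp add: filterlim_uminus_at_top)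
    then have "((\<lambda>\<delta>. ln C' / - ln \<delta> + s) \<longlongrightarrow> 0 + s) (at_right 0)"
      by (intro tendsto_add tendsto_const real_tendsto_divide_at_top[OF tendsto_const])
    then show "((\<lambda>\<delta>. ereal (ln C' / - ln \<delta> + s)) \<longlongrightarrow> ereal s) (at_right 0)"
      by (simp add: tendsto_ereal)
  qed simp
  finally show ?thesis .
qed

section \<open>Grid covers and the bound by the dimension of the space\<close>

text \<open>The set is cut along a half-open cubic grid, the cubes being indexed by the integer
  parts of the scaled coordinates.\<close>

lemma bounded_imp_finite_cover:
  fixes E :: "'a::euclidean_space set"
  assumes "bounded E"
  obtains C where "0 < C" "\<And>\<delta>. 0 < \<delta> \<Longrightarrow> \<delta> \<le> 1 \<Longrightarrow> \<exists>F. finite F \<and> E \<subseteq> \<Union>F \<and>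
    (\<forall>U\<in>F. bounded U \<and> diameter U \<le> \<delta>) \<and> real (card F) \<le> C * \<delta> powr - real DIM('a)"
proof -
  obtain B where B: "1 \<le> B" "\<And>x. x \<in> E \<Longrightarrow> norm x \<le> B"
    using assms unfolding bounded_iff by (metis dual_order.trans linear)
  let ?d = "DIM('a)"
  show ?thesis
  \<comment> \<open>The count is \<open>(2 * m + 1) ^ d\<close> with
    \<open>m \<le> B / h + 1\<close> and \<open>d\<close> the dimension. Since
    \<open>1 \<le> B / h\<close>, the base is at most
    \<open>2 * (B / h) + 3 \<le> 5 * (B / h)\<close>, which gives the 5.\<close>
  proof (rule that[of "(5 * B * real ?d) ^ ?d"])
    show "0 < (5 * B * real ?d) ^ ?d" using B by simp
  next
    fix \<delta> :: real assume \<delta>: "0 < \<delta>" "\<delta> \<le> 1"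
    \<comment> \<open>With this side length, points of one cube differ by at most \<open>h\<close>
      in each coordinate, hence by at most \<delta> in the sum norm, which dominates the Euclidean
      norm.\<close>
    define h where "h = \<delta> / real ?d"
    have h: "0 < h" "h \<le> 1"
      using \<delta> DIM_positive[where 'a='a] by (auto simp: h_def divide_le_eq intro: order_trans[of _ 1])
    define m where "m = \<lceil>B / h\<rceil>"
    have Bh: "1 \<le> B / h" using h B(1) by (simp add: le_divide_eq)
    have m: "B / h \<le> of_int m" "of_int m \<le> B / h + 1" "0 \<le> m"
      using Bh unfolding m_def by (linarith+)
    define I where "I = PiE (Basis::'a set) (\<lambda>_. {-m..m})"
    define U where "U f = {x\<in>E. \<forall>b\<in>Basis. \<lfloor>x \<bullet> b / h\<rfloor> = f b}" for f
    have fin: "finite I" unfolding I_def by (intro finite_PiE) auto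
    have "E \<subseteq> \<Union>(U ` I)"
    proof
      fix x assume x: "x \<in> E"
      define f where "f = restrict (\<lambda>b. \<lfloor>x \<bullet> b / h\<rfloor>) Basis"
      have "\<lfloor>x \<bullet> b / h\<rfloor> \<in> {-m..m}" if "b \<in> Basis" for b
      proof -
        have "\<bar>x \<bullet> b\<bar> \<le> B" using Basis_le_norm[OF that, of x] B(2)[OF x] by simp
        then have "\<bar>x \<bullet> b / h\<bar> \<le> B / h" using h by (simp add: divide_right_mono)
        then have "\<bar>x \<bullet> b / h\<bar> \<le> of_int m" using m(1) by (rule order_trans)
        then show ?thesis unfolding abs_le_iff by (simp add: le_floor_iff floor_le_iff del: abs_divide)
      qed
      then have "f \<in> I" by (auto simp: I_def f_def)
      moreover have "x \<in> U f" using x by (simp add: U_def f_def)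
      ultimately show "x \<in> \<Union>(U ` I)" by blast
    qed
    moreover have "bounded (U f) \<and> diameter (U f) \<le> \<delta>" for f
    proof
      show "bounded (U f)" using assms by (rule bounded_subset) (auto simp: U_def)
      show "diameter (U f) \<le> \<delta>"
      proof (rule diameter_le)
        fix x y assume xy: "x \<in> U f" "y \<in> U f"
        have "norm (x - y) \<le> (\<Sum>b\<in>Basis. \<bar>(x - y) \<bullet> b\<bar>)" by (rule norm_le_l1)
        also have "\<dots> \<le> (\<Sum>b\<in>(Basis::'a set). h)"
        proof (rule sum_mono)
          fix b :: 'a assume "b \<in> Basis"
          then have "\<lfloor>x \<bullet> b / h\<rfloor> = \<lfloor>y \<bullet> b / h\<rfloor>" using xy by (simp add: U_def)
          then have "\<bar>x \<bullet> b / h - y \<bullet> b / h\<bar> \<le> 1" by linarith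
          then have "\<bar>(x \<bullet> b - y \<bullet> b) / h\<bar> \<le> 1" by (simp add: diff_divide_distrib)
          then show "\<bar>(x - y) \<bullet> b\<bar> \<le> h" using h by (simp add: inner_diff_left)
        qed
        also have "\<dots> = \<delta>" using DIM_positive[where 'a='a] by (simp add: h_def)
        finally show "norm (x - y) \<le> \<delta>" .
      qed (use \<delta> in auto)
    qed
    moreover have "real (card (U ` I)) \<le> (5 * B * real ?d) ^ ?d * \<delta> powr - real ?d"
    proof -
      have "real (card (U ` I)) \<le> real (card I)" using card_image_le[OF fin, of U] by simp
      also have "\<dots> = (2 * of_int m + 1) ^ ?d"
        using m(3) by (simp add: I_def card_PiE)
      also have "\<dots> \<le> (5 * (B / h)) ^ ?d"
        using m Bh by (intro power_mono) auto
      also have "\<dots> = (5 * B * real ?d) ^ ?d * \<delta> powr - real ?d"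
        using \<delta> by (simp add: h_def powr_minus powr_realpow power_divide divide_inverse power_mult_distrib power_inverse)
      finally show ?thesis .
    qed
    ultimately show "\<exists>F. finite F \<and> E \<subseteq> \<Union>F \<and> (\<forall>U\<in>F. bounded U \<and> diameter U \<le> \<delta>) \<and>
        real (card F) \<le> (5 * B * real ?d) ^ ?d * \<delta> powr - real ?d"
      using fin by (intro exI[of _ "U ` I"]) auto
  qed
qed

text \<open>At most \<open>C * \<delta> powr - d\<close> pieces, each of diameter at most \<delta>,
  keep the sums of \<open>d\<close>-th powers below \<open>C\<close>, where \<open>d\<close> is the
  dimension of the space.\<close>

lemma hausdorff_dim_le_DIM:
  fixes E :: "'a::euclidean_space set"
  assumes "bounded E"
  shows "hausdorff_dim E \<le> ereal (real DIM('a))"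
proof -
  obtain C where C: "0 < C" "\<And>\<delta>. 0 < \<delta> \<Longrightarrow> \<delta> \<le> 1 \<Longrightarrow> \<exists>F. finite F \<and> E \<subseteq> \<Union>F \<and>
    (\<forall>U\<in>F. bounded U \<and> diameter U \<le> \<delta>) \<and> real (card F) \<le> C * \<delta> powr - real DIM('a)"
    using bounded_imp_finite_cover[OF assms] by blast
  show ?thesis
  proof (rule hausdorff_dim_le[where C = C])
    fix \<delta>' :: real assume "0 < \<delta>'"
    define \<delta> where "\<delta> = min \<delta>' 1"
    have \<delta>: "0 < \<delta>" "\<delta> \<le> 1" "\<delta> \<le> \<delta>'" using \<open>0 < \<delta>'\<close> by (auto simp: \<delta>_def)
    obtain F where F: "finite F" "E \<subseteq> \<Union>F" "\<And>U. U \<in> F \<Longrightarrow> bounded U \<and> diameter U \<le> \<delta>"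
      "real (card F) \<le> C * \<delta> powr - real DIM('a)"
      using C(2)[OF \<delta>(1,2)] by blast
    have "(\<Sum>U\<in>F. diameter U powr real DIM('a)) \<le> (\<Sum>U\<in>F. \<delta> powr real DIM('a))"
      using F(3) by (intro sum_mono powr_mono2) (auto simp: diameter_ge_0)
    also have "\<dots> = real (card F) * \<delta> powr real DIM('a)" by simp
    also have "\<dots> \<le> C * \<delta> powr - real DIM('a) * \<delta> powr real DIM('a)"
      using F(4) by (intro mult_right_mono) auto
    also have "\<dots> = C" using \<delta> by (simp add: powr_minus)
    finally have "(\<Sum>U\<in>F. diameter U powr real DIM('a)) \<le> C" .
    moreover have "\<forall>U\<in>F. bounded U \<and> diameter U \<le> \<delta>'"
      using F(3) \<delta>(3) by fastforce
    ultimately show "\<exists>F. finite F \<and> E \<subseteq> \<Union>F \<and> (\<forall>U\<in>F. bounded U \<and> diameter U \<le> \<delta>') \<and>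
        (\<Sum>U\<in>F. diameter U powr real DIM('a)) \<le> C"
      using F(1,2) by blast
  qed simp
qed

lemma upper_box_dim_le_DIM:
  fixes E :: "'a::euclidean_space set"
  assumes "bounded E"
  shows "upper_box_dim E \<le> ereal (real DIM('a))"
proof -
  obtain C where C: "0 < C" "\<And>\<delta>. 0 < \<delta> \<Longrightarrow> \<delta> \<le> 1 \<Longrightarrow> \<exists>F. finite F \<and> E \<subseteq> \<Union>F \<and>
    (\<forall>U\<in>F. bounded U \<and> diameter U \<le> \<delta>) \<and> real (card F) \<le> C * \<delta> powr - real DIM('a)"
    using bounded_imp_finite_cover[OF assms] by blast
  have "\<forall>\<^sub>F \<delta> in at_right 0. real (box_count \<delta> E) \<le> C * \<delta> powr - real DIM('a)"
    using eventually_at_right_real[OF zero_less_one]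
  proof eventually_elim
    case (elim \<delta>)
    then obtain F where F: "finite F" "E \<subseteq> \<Union>F" "\<And>U. U \<in> F \<Longrightarrow> bounded U \<and> diameter U \<le> \<delta>"
      "real (card F) \<le> C * \<delta> powr - real DIM('a)"
      using C(2)[of \<delta>] by auto
    then show ?case using box_count_le_card[OF F(1-3)] by simp
  qed
  then show ?thesis by (intro upper_box_dim_le) auto
qed


section \<open>Weights of words\<close>

definition weight :: "(nat \<Rightarrow> nat \<Rightarrow> real) \<Rightarrow> nat list \<Rightarrow> real" where
  "weight c u = (\<Prod>j = 1..length u. c j (u ! (j - 1)))"

text \<open>As a function of \<open>t\<close>, this is the left-hand side of the equation whose root
  is \<open>critical_exponent n c k\<close>.\<close>

definition level_sum :: "(nat \<Rightarrow> nat) \<Rightarrow> (nat \<Rightarrow> nat \<Rightarrow> real) \<Rightarrow> nat \<Rightarrow> real \<Rightarrow> real" where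
  "level_sum n c k t = (\<Prod>i = 1..k. \<Sum>j = 1..n i. c i j powr t)"

lemma weight_Nil [simp]: "weight c [] = 1"
  by (simp add: weight_def)

lemma weight_snoc: "weight c (u @ [i]) = weight c u * c (Suc (length u)) i"
proof -
  have "(\<Prod>j = 1..length u. c j ((u @ [i]) ! (j - 1))) = (\<Prod>j = 1..length u. c j (u ! (j - 1)))"
    by (intro prod.cong) (auto simp: nth_append)
  then show ?thesis by (simp add: weight_def prod.nat_ivl_Suc')
qed

lemma words_0 [simp]: "words n 0 = {[]}"
  by (auto simp: words_def)

lemma length_words: "u \<in> words n k \<Longrightarrow> length u = k"
  by (simp add: words_def)

lemma words_nth: "u \<in> words n k \<Longrightarrow> 1 \<le> j \<Longrightarrow> j \<le> k \<Longrightarrow> u ! (j - 1) \<in> {1..n j}"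
  by (simp add: words_def)

lemma snoc_mem_words_iff: "u @ [i] \<in> words n (Suc k) \<longleftrightarrow> u \<in> words n k \<and> i \<in> {1..n (Suc k)}"
proof -
  have "(\<forall>j\<in>{1..Suc k}. (u @ [i]) ! (j - 1) \<in> {1..n j}) \<longleftrightarrow>
      (\<forall>j\<in>{1..k}. u ! (j - 1) \<in> {1..n j}) \<and> i \<in> {1..n (Suc k)}" if "length u = k"
    using that by (auto simp: nth_append atLeastAtMostSuc_conv)
  then show ?thesis by (auto simp: words_def)
qed

lemma words_SucE:
  assumes "v \<in> words n (Suc k)"
  obtains u i where "v = u @ [i]" "u \<in> words n k" "i \<in> {1..n (Suc k)}"
proof -
  have "v \<noteq> []" using length_words[OF assms] by auto
  then obtain u i where "v = u @ [i]" by (cases v rule: rev_cases) auto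
  with assms that show ?thesis using snoc_mem_words_iff by blast
qed

lemma finite_words: "finite (words n k)"
proof (induction k)
  case (Suc k)
  have "words n (Suc k) \<subseteq> (\<lambda>(u, i). u @ [i]) ` (words n k \<times> {1..n (Suc k)})"
    by (auto elim!: words_SucE)
  then show ?case using Suc by (auto intro: finite_subset)
qed simp

locale contraction_weights =
  fixes n :: "nat \<Rightarrow> nat" and c :: "nat \<Rightarrow> nat \<Rightarrow> real"
  assumes n_ge_2: "\<And>k. k \<ge> 1 \<Longrightarrow> n k \<ge> 2"
    and c_bounds: "\<And>k i. k \<ge> 1 \<Longrightarrow> i \<in> {1..n k} \<Longrightarrow> 0 < c k i \<and> c k i < 1"
begin

lemma weight_pos: "u \<in> words n k \<Longrightarrow> 0 < weight c u"
  unfolding weight_def using c_bounds words_nth length_words by (intro prod_pos) force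

lemma sum_pos_level: "1 \<le> k \<Longrightarrow> 0 < (\<Sum>j = 1..n k. c k j powr t)"
  using n_ge_2[of k] c_bounds[of k] by (intro sum_pos) fastforce+

lemma level_sum_pos: "0 < level_sum n c k t"
  unfolding level_sum_def using sum_pos_level by (intro prod_pos) auto

text \<open>Extending a word by one letter multiplies its weight by one ratio, so the sum over the
  children of a family of words factorises. The predicate \<open>Q\<close> selects the parents: all
  words for the level sums, the unstopped ones for \<open>sum_stop\<close>.\<close>

lemma sum_weight_Suc:
  "(\<Sum>v | v \<in> words n (Suc k) \<and> Q (butlast v). weight c v powr t) =
   (\<Sum>u | u \<in> words n k \<and> Q u. weight c u powr t) * (\<Sum>j = 1..n (Suc k). c (Suc k) j powr t)"
proof -
  let ?X = "{u \<in> words n k. Q u} \<times> {1..n (Suc k)}"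
  have "{v \<in> words n (Suc k). Q (butlast v)} = (\<lambda>(u, i). u @ [i]) ` ?X"
    by (auto simp: snoc_mem_words_iff image_iff elim!: words_SucE)
  moreover have "inj_on (\<lambda>(u, i). u @ [i]) ?X" by (auto simp: inj_on_def)
  ultimately have "(\<Sum>v | v \<in> words n (Suc k) \<and> Q (butlast v). weight c v powr t) =
      (\<Sum>(u, i)\<in>?X. weight c (u @ [i]) powr t)"
    by (simp add: sum.reindex case_prod_unfold)
  also have "\<dots> = (\<Sum>(u, i)\<in>?X. weight c u powr t * c (Suc k) i powr t)"
  proof (rule sum.cong, simp, clarify)
    fix u i assume ui: "u \<in> words n k" "i \<in> {1..n (Suc k)}"
    then show "weight c (u @ [i]) powr t = weight c u powr t * c (Suc k) i powr t"
      using length_words[OF ui(1)] by (simp add: weight_snoc powr_mult)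
  qed
  also have "\<dots> = (\<Sum>u | u \<in> words n k \<and> Q u. weight c u powr t) * (\<Sum>j = 1..n (Suc k). c (Suc k) j powr t)"
    by (simp add: sum_product sum.cartesian_product)
  finally show ?thesis .
qed

lemma level_sum_Suc: "level_sum n c (Suc k) t = level_sum n c k t * (\<Sum>j = 1..n (Suc k). c (Suc k) j powr t)"
  by (simp add: level_sum_def prod.nat_ivl_Suc')

lemma sum_weight_words: "(\<Sum>u\<in>words n k. weight c u powr t) = level_sum n c k t"
proof (induction k)
  case 0
  then show ?case by (simp add: level_sum_def)
next
  case (Suc k)
  then show ?case using sum_weight_Suc[where Q = "\<lambda>_. True" and k = k and t = t]
    by (simp add: level_sum_Suc)
qed

section \<open>Critical exponents as roots of the level sums\<close>

lemma level_sum_strict_antimono: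
  assumes "1 \<le> k" "s < t"
  shows "level_sum n c k t < level_sum n c k s"
  unfolding level_sum_def
proof (rule prod_mono_strict[where i = 1])
  fix i assume i: "i \<in> {1..k}"
  then show "0 \<le> (\<Sum>j = 1..n i. c i j powr t) \<and>
      (\<Sum>j = 1..n i. c i j powr t) \<le> (\<Sum>j = 1..n i. c i j powr s)"
    using c_bounds[of i] assms by (auto intro!: sum_nonneg sum_mono powr_mono' intro: less_imp_le)
next
  show "\<And>i. i \<in> {1..k} \<Longrightarrow> 0 < (\<Sum>j = 1..n i. c i j powr s)" using sum_pos_level by auto
  show "(\<Sum>j = 1..n 1. c 1 j powr t) < (\<Sum>j = 1..n 1. c 1 j powr s)"
    using assms c_bounds[of 1] n_ge_2[of 1]
    by (intro sum_strict_mono) (auto intro!: powr_less_mono')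
qed (use assms in auto)

text \<open>With at least two letters per level the value at 0 is at least \<open>2 ^ k\<close>, and
  the limit at infinity is 0. The intermediate value theorem gives a root, strict monotonicity makes
  it unique, and it is not 0 because the value there exceeds 1.\<close>

lemma level_sum_critical_exponent:
  assumes "1 \<le> k"
  shows "0 < critical_exponent n c k" "level_sum n c k (critical_exponent n c k) = 1"
proof -
  let ?f = "level_sum n c k"
  have f0: "1 < ?f 0"
  proof -
    have "(1::real) < (\<Prod>i = 1..k. 2)" using assms by simp
    also have "\<dots> \<le> ?f 0" unfolding level_sum_def
    proof (rule prod_mono)
      fix i assume "i \<in> {1..k}"
      then have "(\<Sum>j = 1..n i. c i j powr 0) = (\<Sum>j = 1..n i. 1)"
        using c_bounds[of i] by (intro sum.cong) fastforce+
      then show "(0::real) \<le> 2 \<and> 2 \<le> (\<Sum>j = 1..n i. c i j powr 0)"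
        using n_ge_2[of i] \<open>i \<in> {1..k}\<close> by simp
    qed
    finally show ?thesis .
  qed
  have "((\<lambda>t. \<Prod>i = 1..k. \<Sum>j = 1..n i. c i j powr t) \<longlongrightarrow> (\<Prod>i = 1..k. \<Sum>j = 1..n i. 0)) at_top"
  proof (intro tendsto_prod tendsto_sum)
    fix i j assume "i \<in> {1..k}" "j \<in> {1..n i}"
    then have cij: "0 < c i j" "c i j < 1" using c_bounds[of i j] by auto
    have "((\<lambda>t. exp (ln (c i j) * t)) \<longlongrightarrow> 0) at_top"
      using cij by (intro filterlim_compose[OF exp_at_bot] filterlim_tendsto_neg_mult_at_bot[OF tendsto_const] filterlim_ident) auto
    then show "((\<lambda>t. c i j powr t) \<longlongrightarrow> 0) at_top" using cij by (simp add: powr_def mult.commute)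
  qed
  moreover have "(\<Prod>i = 1..k. \<Sum>j = 1..n i. 0) = (0::real)" using assms by (simp add: power_0_left)
  ultimately have "(?f \<longlongrightarrow> 0) at_top" by (subst level_sum_def[abs_def]) (simp only:)
  then have "\<forall>\<^sub>F t in at_top. ?f t < 1" by (rule order_tendstoD) simp
  then obtain T where T: "0 \<le> T" "?f T < 1"
    by (metis (mono_tags, lifting) eventually_at_top_linorder linear)
  have "continuous_on {0..T} ?f"
    unfolding level_sum_def[abs_def]
  proof (intro continuous_on_prod continuous_on_sum)
    fix i j assume "i \<in> {1..k}" "j \<in> {1..n i}"
    then have "c i j \<noteq> 0" using c_bounds[of i j] by auto
    then show "continuous_on {0..T} (\<lambda>t. c i j powr t)"
      by (intro continuous_on_powr) (auto intro: continuous_intros)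
  qed
  then obtain t where t: "0 \<le> t" "?f t = 1"
    using IVT2'[of ?f T 1 0] T f0 by auto
  have uniq: "t' = t" if "?f t' = 1" for t'
    using level_sum_strict_antimono[OF assms, of t t'] level_sum_strict_antimono[OF assms, of t' t] t that
    by (metis less_irrefl linorder_neqE)
  have "critical_exponent n c k = t"
    unfolding critical_exponent_def using t(2) uniq unfolding level_sum_def by (rule the_equality)
  moreover have "t \<noteq> 0" using t f0 by auto
  ultimately show "0 < critical_exponent n c k" "?f (critical_exponent n c k) = 1"
    using t by auto
qed

lemma level_sum_le_1:
  assumes "1 \<le> k" "critical_exponent n c k < s"
  shows "level_sum n c k s \<le> 1"
  using level_sum_strict_antimono[OF assms] level_sum_critical_exponent[OF assms(1)] by simp

section \<open>Lower and upper bounds for weights when the ratios stay away from 0\<close>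

text \<open>Serves to show that a word of weight below \<open>a ^ K\<close> is longer than
  \<open>K\<close>.\<close>

lemma weight_ge_power:
  assumes "0 \<le> a" "\<And>k i. 1 \<le> k \<Longrightarrow> i \<in> {1..n k} \<Longrightarrow> a \<le> c k i" "u \<in> words n k"
  shows "a ^ k \<le> weight c u"
proof -
  have "(\<Prod>j = 1..k. a) \<le> (\<Prod>j = 1..k. c j (u ! (j - 1)))"
    using assms(1,2) words_nth[OF assms(3)] by (intro prod_mono) auto
  then show ?thesis using length_words[OF assms(3)] by (simp add: weight_def)
qed

text \<open>Each level has at least two letters, so the letter used by \<open>u\<close> accounts for at most the
  fraction \<open>1 / (1 + a powr s)\<close> of the sum over that level.\<close>

lemma weight_powr_le_level_sum:
  assumes "0 < a" "\<And>k i. 1 \<le> k \<Longrightarrow> i \<in> {1..n k} \<Longrightarrow> a \<le> c k i" "0 \<le> s" "u \<in> words n k"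
  shows "weight c u powr s * (1 + a powr s) ^ k \<le> level_sum n c k s"
  using assms(4)
proof (induction k arbitrary: u)
  case 0
  then show ?case by (simp add: level_sum_def)
next
  case (Suc k)
  then obtain w i where u: "u = w @ [i]" "w \<in> words n k" "i \<in> {1..n (Suc k)}"
    by (auto elim: words_SucE)
  let ?b = "c (Suc k) i"
  have b: "0 < ?b" "?b < 1" using c_bounds[of "Suc k" i] u by auto
  define j where "j = (if i = 1 then 2 else 1::nat)"
  have j: "j \<in> {1..n (Suc k)}" "j \<noteq> i"
    using n_ge_2[of "Suc k"] by (auto simp: j_def)
  \<comment> \<open>A second letter \<open>j\<close> contributes at least \<open>a powr s\<close>,
    and \<open>?b powr s \<le> 1\<close>; so the letters \<open>i\<close> and \<open>j\<close>
    together contribute at least \<open>?b powr s * (1 + a powr s)\<close>.\<close>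
  have "?b powr s * a powr s \<le> 1 * c (Suc k) j powr s"
    using b assms(1,3) assms(2)[OF _ j(1)] by (intro mult_mono powr_mono2 powr_le1) auto
  then have "?b powr s * (1 + a powr s) \<le> (\<Sum>l\<in>{i, j}. c (Suc k) l powr s)"
    using j(2) by (simp add: algebra_simps)
  also have "\<dots> \<le> (\<Sum>l = 1..n (Suc k). c (Suc k) l powr s)"
    using u(3) j(1) by (intro sum_mono2) auto
  finally have "(weight c w powr s * (1 + a powr s) ^ k) * (?b powr s * (1 + a powr s)) \<le>
      level_sum n c k s * (\<Sum>l = 1..n (Suc k). c (Suc k) l powr s)"
    using Suc.IH[OF u(2)] level_sum_pos[of k s] by (intro mult_mono) auto
  then show ?case
    using u(1) b weight_pos[OF u(2)] length_words[OF u(2)]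
    by (simp add: weight_snoc level_sum_Suc powr_mult mult_ac)
qed

section \<open>Stopping words at a given weight\<close>

text \<open>The empty word has weight 1, above \<delta>, so the first prefix of weight at most
  \<delta> is non-empty and has a parent that is still above \<delta>.\<close>

lemma take_weight_le:
  assumes "u \<in> words n k" "\<delta> < 1" "weight c u \<le> \<delta>"
  obtains j where "j < k" "\<delta> < weight c (take j u)" "weight c (take (Suc j) u) \<le> \<delta>"
proof -
  have "\<exists>j<k. (\<forall>i\<le>j. \<not> weight c (take i u) \<le> \<delta>) \<and> weight c (take (Suc j) u) \<le> \<delta>"
    using assms length_words[OF assms(1)]
        ex_least_nat_less[of "\<lambda>j. weight c (take j u) \<le> \<delta>" k] by auto
  with that show ?thesis by auto
qed

text \<open>The index is shifted: \<open>stop \<delta> k\<close> contains words of length \<open>Suc k\<close>. Since the weight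
  decreases along prefixes, it suffices to test the longest proper prefix.\<close>

definition stop :: "real \<Rightarrow> nat \<Rightarrow> nat list set" where
  "stop \<delta> k = {v \<in> words n (Suc k). \<delta> < weight c (butlast v) \<and> weight c v \<le> \<delta>}"

lemma finite_stop: "finite (stop \<delta> k)"
  unfolding stop_def using finite_words[of n "Suc k"] by (rule rev_finite_subset) auto

text \<open>The total mass of the probability measure on infinite words, split according to the time
  of stopping; the last summand belongs to the words not stopped up to time \<open>m\<close>.\<close>

lemma sum_stop:
  assumes "\<delta> < 1"
  shows "(\<Sum>k<m. (\<Sum>v\<in>stop \<delta> k. weight c v powr s) / level_sum n c (Suc k) s) +
    (\<Sum>u | u \<in> words n m \<and> \<delta> < weight c u. weight c u powr s) / level_sum n c m s = 1"
proof (induction m)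
  case 0
  have "{u. u = [] \<and> \<delta> < weight c u} = {[]}" using assms by auto
  then show ?case by (simp add: level_sum_def)
next
  case (Suc m)
  let ?A = "{u \<in> words n (Suc m). \<delta> < weight c u}"
  have le: "weight c v \<le> weight c (butlast v)" if "v \<in> words n (Suc m)" for v
    using that
  proof (rule words_SucE)
    fix u i assume v: "v = u @ [i]" "u \<in> words n m" "i \<in> {1..n (Suc m)}"
    then show ?thesis
      using c_bounds[of "Suc m" i] weight_pos[OF v(2)] length_words[OF v(2)]
      by (simp add: weight_snoc mult_le_cancel_left1)
  qed
  \<comment> \<open>By \<open>le\<close>, a word still above \<delta> has a parent above \<delta>.
    Hence the children of the unstopped words are exactly those that stop now and those that
    remain.\<close>
  have "{v \<in> words n (Suc m). \<delta> < weight c (butlast v)} = stop \<delta> m \<union> ?A"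
    using le by (fastforce simp: stop_def)
  moreover have "stop \<delta> m \<inter> ?A = {}" by (auto simp: stop_def)
  moreover have "finite ?A" using finite_words[of n "Suc m"] by (rule rev_finite_subset) auto
  ultimately have "(\<Sum>v\<in>stop \<delta> m. weight c v powr s) + (\<Sum>u\<in>?A. weight c u powr s) =
      (\<Sum>u | u \<in> words n m \<and> \<delta> < weight c u. weight c u powr s) *
      (\<Sum>j = 1..n (Suc m). c (Suc m) j powr s)"
    using sum_weight_Suc[where Q = "\<lambda>u. \<delta> < weight c u" and k = m and t = s]
    by (simp add: sum.union_disjoint finite_stop)
  \<comment> \<open>The level factor cancels against that in \<open>level_sum n c (Suc m) s\<close>:
    the mass of the unstopped words passes unchanged to their children.\<close>
  then have "(\<Sum>v\<in>stop \<delta> m. weight c v powr s) / level_sum n c (Suc m) s +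
      (\<Sum>u\<in>?A. weight c u powr s) / level_sum n c (Suc m) s =
      (\<Sum>u | u \<in> words n m \<and> \<delta> < weight c u. weight c u powr s) / level_sum n c m s"
    using sum_pos_level[of "Suc m" s] unfolding level_sum_Suc
    by (simp flip: add_divide_distrib)
  with Suc show ?case by simp
qed

text \<open>\<open>W\<close> collects all words stopped up to a level \<open>M\<close> by which
  every word has stopped. The condition \<open>\<delta> < a ^ K\<close> forces stopped words to be
  long, so that only levels with \<open>level_sum\<close> at most 1 enter the count.\<close>

lemma exists_cut:
  assumes a: "0 < a" "\<And>k i. 1 \<le> k \<Longrightarrow> i \<in> {1..n k} \<Longrightarrow> a \<le> c k i"
    and s: "0 < s" and K: "\<And>k. K \<le> k \<Longrightarrow> level_sum n c k s \<le> 1"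
    and \<delta>: "0 < \<delta>" "\<delta> < 1" "\<delta> < a ^ K"
  obtains W M where "finite W" "real (card W) \<le> (a * \<delta>) powr (- s)"
    "\<forall>u\<in>W. u \<in> all_words n \<and> weight c u \<le> \<delta>" "1 \<le> M"
    "\<forall>u\<in>words n M. \<exists>j\<le>M. take j u \<in> W"
proof -
  have a1: "a < 1" using a(2)[of 1 1] c_bounds[of 1 1] n_ge_2[of 1] by force
  have "1 < 1 + a powr s" using a(1) by simp
  then obtain M0 where M0: "\<delta> powr (- s) < (1 + a powr s) ^ M0" using real_arch_pow by blast
  \<comment> \<open>\<open>M0\<close> makes \<open>(1 + a powr s) ^ M\<close> exceed
    \<open>\<delta> powr (- s)\<close>, \<open>K\<close> ensures that the level sum is at most 1,
    and \<open>Suc\<close> makes the level positive, as covering the attractor requires.\<close>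
  define M where "M = Suc (max M0 K)"
  have M: "\<delta> powr (- s) < (1 + a powr s) ^ M"
    by (rule less_le_trans[OF M0 power_increasing]) (simp_all add: M_def)
  have weight_M: "weight c u \<le> \<delta>" if "u \<in> words n M" for u
  proof (rule ccontr)
    assume "\<not> weight c u \<le> \<delta>"
    then have "\<delta> powr s \<le> weight c u powr s" using \<delta> s by (intro powr_mono2) auto
    then have "\<delta> powr s * \<delta> powr (- s) < weight c u powr s * (1 + a powr s) ^ M"
      using M \<delta> weight_pos[OF that] by (intro mult_le_less_imp_less) auto
    also have "\<dots> \<le> level_sum n c M s"
      using a s that by (intro weight_powr_le_level_sum) auto
    also have "\<dots> \<le> 1" by (intro K) (simp add: M_def)
    finally show False using \<delta> by (simp flip: powr_add)
  qed
  \<comment> \<open>The parent weighs more than \<delta> and the last ratio is at least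
    \<open>a\<close>, so the weight drops below \<delta> by at most the factor \<open>a\<close>. For
    the length, compare \<open>a ^ Suc k \<le> weight c v \<le> \<delta> < a ^ K\<close>.\<close>
  have stop_ge: "a * \<delta> \<le> weight c v" "K \<le> Suc k" if v_stop: "v \<in> stop \<delta> k" for v k
  proof -
    obtain u i where v: "v = u @ [i]" "u \<in> words n k" "i \<in> {1..n (Suc k)}"
      using v_stop by (auto simp: stop_def elim: words_SucE)
    have "\<delta> * a \<le> weight c u * c (Suc k) i"
      using v_stop v a(1) a(2)[OF _ v(3)] \<delta> by (intro mult_mono) (auto simp: stop_def)
    then show "a * \<delta> \<le> weight c v" using v length_words[OF v(2)] by (simp add: weight_snoc mult.commute)
    have "a ^ Suc k \<le> weight c v"
      using v_stop a by (intro weight_ge_power) (auto simp: stop_def)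
    also have "\<dots> < a ^ K" using v_stop \<delta> by (auto simp: stop_def)
    finally have "K < Suc k" using a(1) a1 by (simp only: power_strict_decreasing_iff)
    then show "K \<le> Suc k" by simp
  qed
  define W where "W = (\<Union>k<M. stop \<delta> k)"
  have card: "real (card (stop \<delta> k)) * (a * \<delta>) powr s \<le>
      (\<Sum>v\<in>stop \<delta> k. weight c v powr s) / level_sum n c (Suc k) s" for k
  proof (cases "stop \<delta> k = {}")
    case False
    then have "level_sum n c (Suc k) s \<le> 1" using K stop_ge(2) by blast
    have "real (card (stop \<delta> k)) * (a * \<delta>) powr s = (\<Sum>v\<in>stop \<delta> k. (a * \<delta>) powr s)" by simp
    also have "\<dots> \<le> (\<Sum>v\<in>stop \<delta> k. weight c v powr s)"
      using stop_ge(1) a(1) \<delta> s by (intro sum_mono powr_mono2) auto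
    \<comment> \<open>Dividing by a positive level sum that is at most 1 can only increase the
      value.\<close>
    also have "\<dots> \<le> (\<Sum>v\<in>stop \<delta> k. weight c v powr s) / level_sum n c (Suc k) s"
      using \<open>level_sum n c (Suc k) s \<le> 1\<close> level_sum_pos[of "Suc k" s]
      by (simp add: le_divide_eq mult_left_le sum_nonneg)
    finally show ?thesis .
  qed simp
  have "real (card W) * (a * \<delta>) powr s \<le> (\<Sum>k<M. real (card (stop \<delta> k))) * (a * \<delta>) powr s"
    using card_UN_le[of "{..<M}" "stop \<delta>"]
    by (intro mult_right_mono) (auto simp: W_def simp flip: of_nat_sum)
  also have "\<dots> \<le> (\<Sum>k<M. (\<Sum>v\<in>stop \<delta> k. weight c v powr s) / level_sum n c (Suc k) s)"
    unfolding sum_distrib_right by (intro sum_mono card)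
  \<comment> \<open>The total mass is 1, and the mass of the unstopped words is nonnegative.\<close>
  also have "\<dots> \<le> 1"
  proof -
    have "0 \<le> (\<Sum>u | u \<in> words n M \<and> \<delta> < weight c u. weight c u powr s) / level_sum n c M s"
      using level_sum_pos[of M s] by (intro divide_nonneg_pos sum_nonneg) auto
    then show ?thesis using sum_stop[OF \<delta>(2), where m = M and s = s] by linarith
  qed
  finally have "real (card W) \<le> 1 / (a * \<delta>) powr s"
    using a(1) \<delta> by (simp add: le_divide_eq)
  then have card_W: "real (card W) \<le> (a * \<delta>) powr (- s)" by (simp add: powr_minus_divide)
  show ?thesis
  proof (rule that[OF _ card_W])
    show "finite W" by (simp add: W_def finite_stop)
    show "\<forall>u\<in>W. u \<in> all_words n \<and> weight c u \<le> \<delta>"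
      by (auto simp: W_def stop_def all_words_def)
    show "1 \<le> M" by (simp add: M_def)
    show "\<forall>u\<in>words n M. \<exists>j\<le>M. take j u \<in> W"
    proof
      fix u assume u: "u \<in> words n M"
      obtain j where j: "j < M" "\<delta> < weight c (take j u)" "weight c (take (Suc j) u) \<le> \<delta>"
        using take_weight_le[OF u \<delta>(2) weight_M[OF u]] .
      then have "take (Suc j) u \<in> stop \<delta> j"
        using take_words[OF u, of "Suc j"] length_words[OF u]
        by (simp add: stop_def butlast_take)
      with j(1) show "\<exists>j\<le>M. take j u \<in> W" by (auto simp: W_def intro!: exI[of _ "Suc j"])
    qed
  qed
qed

end

section \<open>The attractor\<close>

lemma nonautonomous_structureD:
  assumes "nonautonomous_structure n S J \<omega> JJ" "u \<in> words n k"
  shows "JJ u \<subseteq> J" "JJ u = psi_comp S \<omega> u 0 ` J"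
  using assms unfolding nonautonomous_structure_def all_words_def by blast+

text \<open>Lets the sets of stopped prefixes inherit the covering property of a full level.\<close>

lemma nonautonomous_structure_nested:
  assumes str: "nonautonomous_structure n S J \<omega> JJ" and "u \<in> words n k" "j \<le> k"
  shows "JJ u \<subseteq> JJ (take j u)"
  using assms(2,3)
proof (induction k arbitrary: u)
  case (Suc k)
  from Suc.prems(1) obtain w i where u: "u = w @ [i]" "w \<in> words n k" "i \<in> {1..n (Suc k)}"
    by (auto elim: words_SucE)
  have "\<forall>k\<ge>1. \<forall>u\<in>words n (k - 1). \<forall>i\<in>{1..n k}. JJ (u @ [i]) \<subseteq> JJ u"
    using str unfolding nonautonomous_structure_def by blast
  from this[rule_format, of "Suc k" w i] have "JJ u \<subseteq> JJ w" using u by simp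
  show ?case
  proof (cases "j = Suc k")
    case True
    then show ?thesis using length_words[OF Suc.prems(1)] by simp
  next
    case False
    then show ?thesis
      using Suc.IH[OF u(2)] Suc.prems(2) \<open>JJ u \<subseteq> JJ w\<close> u(1) length_words[OF u(2)] by auto
  qed
qed simp

section \<open>Contraction along a word\<close>

lemma psi_comp_Suc:
  assumes "j < length u"
  shows "psi_comp S \<omega> u j = psi S \<omega> (take (Suc j) u) \<circ> psi_comp S \<omega> u (Suc j)"
proof -
  have "[Suc j..<Suc (length u)] = Suc j # [Suc (Suc j)..<Suc (length u)]"
    using assms by (simp add: upt_conv_Cons del: upt_Suc)
  then show ?thesis unfolding psi_comp_def by (simp only: list.map foldr_Cons comp_apply)
qed

lemma psi_comp_lipschitz:
  assumes u: "u \<in> words n k"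
    and c: "\<And>j i. 1 \<le> j \<Longrightarrow> i \<in> {1..n j} \<Longrightarrow> 0 \<le> c j i"
    and lip: "\<And>j x y. 1 \<le> j \<Longrightarrow> j \<le> k \<Longrightarrow>
          x \<in> psi_comp S \<omega> u j ` J \<Longrightarrow> y \<in> psi_comp S \<omega> u j ` J \<Longrightarrow>
          norm (S j (u ! (j - 1)) x - S j (u ! (j - 1)) y) \<le> c j (u ! (j - 1)) * norm (x - y)"
    and xy: "x \<in> J" "y \<in> J"
  shows "norm (psi_comp S \<omega> u 0 x - psi_comp S \<omega> u 0 y) \<le> weight c u * norm (x - y)"
proof -
  have "norm (psi_comp S \<omega> u m x - psi_comp S \<omega> u m y) \<le>
      (\<Prod>j = Suc m..k. c j (u ! (j - 1))) * norm (x - y)" if "m \<le> k" for m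
    using that
  \<comment> \<open>The induction runs downwards from \<open>m = k\<close>, where the composition is
    the identity, and adds one outer map at a time.\<close>
  proof (induction rule: inc_induct)
    case base
    then show ?case using length_words[OF u] by (simp add: psi_comp_def)
  next
    case (step m)
    let ?f = "psi_comp S \<omega> u (Suc m)"
    have "last (take (Suc m) u) = u ! m"
      using step length_words[OF u] by (simp add: take_Suc_conv_app_nth)
    then have "norm (psi_comp S \<omega> u m x - psi_comp S \<omega> u m y) =
        norm (S (Suc m) (u ! m) (?f x) - S (Suc m) (u ! m) (?f y))"
      using step length_words[OF u] by (simp add: psi_comp_Suc psi_def)
    also have "\<dots> \<le> c (Suc m) (u ! m) * norm (?f x - ?f y)"
      using lip[of "Suc m" "?f x" "?f y"] step xy by simp
    also have "\<dots> \<le> c (Suc m) (u ! m) * ((\<Prod>j = Suc (Suc m)..k. c j (u ! (j - 1))) * norm (x - y))"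
      using step c[of "Suc m" "u ! m"] words_nth[OF u, of "Suc m"] by (intro mult_left_mono) auto
    also have "\<dots> = (\<Prod>j = Suc m..k. c j (u ! (j - 1))) * norm (x - y)"
      using step by (subst (2) prod.atLeast_Suc_atMost) auto
    finally show ?case .
  qed
  from this[of 0] show ?thesis using length_words[OF u] by (simp add: weight_def)
qed

lemma attractor_subset_level: "1 \<le> k \<Longrightarrow> attractor n JJ \<subseteq> (\<Union>u\<in>words n k. JJ u)"
  unfolding attractor_def by blast

text \<open>The hypothesis \<open>lipschitz_along\<close> supplies the ratios on the inner images,
  which can leave \<open>J\<close>; for injective maps \<open>psi_comp_image_subset_if_inj\<close>
  places these images in \<open>J\<close>.\<close>

theorem theorem2p1:
  fixes n :: "nat \<Rightarrow> nat"
    and S :: "nat \<Rightarrow> nat \<Rightarrow> 'a \<Rightarrow> 'a::euclidean_space"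
    and J :: "'a set"
    and \<omega> :: "nat list \<Rightarrow> 'a"
    and JJ :: "nat list \<Rightarrow> 'a set"
    and c :: "nat \<Rightarrow> nat \<Rightarrow> real"
  assumes n: "\<And>k. k \<ge> 1 \<Longrightarrow> n k \<ge> 2"
    and J: "compact J" "interior J \<noteq> {}"
    and contractive: "\<And>k i. k \<ge> 1 \<Longrightarrow> i \<in> {1..n k} \<Longrightarrow>
          \<exists>L. 0 < L \<and> L < 1 \<and> L-lipschitz_on UNIV (S k i)"
    and nas: "nonautonomous_structure n S J \<omega> JJ"
    and c: "\<And>k i. k \<ge> 1 \<Longrightarrow> i \<in> {1..n k} \<Longrightarrow> 0 < c k i \<and> c k i < 1"
    and lipschitz: "\<And>k i x y. k \<ge> 1 \<Longrightarrow> i \<in> {1..n k} \<Longrightarrow> x \<in> J \<Longrightarrow> y \<in> J \<Longrightarrow>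
          norm (S k i x - S k i y) \<le> c k i * norm (x - y)"
    and lipschitz_along: "\<And>k u j x y. u \<in> words n k \<Longrightarrow> 1 \<le> j \<Longrightarrow> j < k \<Longrightarrow>
          x \<in> psi_comp S \<omega> u j ` J \<Longrightarrow> y \<in> psi_comp S \<omega> u j ` J \<Longrightarrow>
          norm (S j (u ! (j - 1)) x - S j (u ! (j - 1)) y) \<le> c j (u ! (j - 1)) * norm (x - y)"
  shows "hausdorff_dim (attractor n JJ)
           \<le> min (liminf (\<lambda>k. ereal (critical_exponent n c k))) (ereal (real DIM('a)))
       \<and> (0 < Inf {c k j |k j. 1 \<le> k \<and> 1 \<le> j \<and> j \<le> n k} \<longrightarrow>
           upper_box_dim (attractor n JJ)
             \<le> min (limsup (\<lambda>k. ereal (critical_exponent n c k))) (ereal (real DIM('a))))"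
proof -
  interpret contraction_weights n c using n c by unfold_locales blast+
  let ?E = "attractor n JJ" and ?dim = "\<lambda>k. ereal (critical_exponent n c k)"
  have bounded_JJ: "bounded (JJ u)" if "u \<in> words n k" for u k
    using compact_imp_bounded[OF J(1)] nonautonomous_structureD(1)[OF nas that] by (rule bounded_subset)
  have "?E \<subseteq> J"
    using attractor_subset_level[of 1 n JJ] nonautonomous_structureD(1)[OF nas, of _ 1] by blast
  with compact_imp_bounded[OF J(1)] have bounded_E: "bounded ?E" by (rule bounded_subset)
  \<comment> \<open>The added 1 makes \<open>D\<close> visibly positive, so that scales can be
    divided by it.\<close>
  define D where "D = diameter J + 1"
  have D: "0 < D" using diameter_ge_0[OF compact_imp_bounded[OF J(1)]] by (simp add: D_def)
  have diam: "diameter (JJ u) \<le> weight c u * D" if u: "u \<in> words n k" for u k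
  proof (rule diameter_le)
    show "JJ u \<noteq> {} \<or> 0 \<le> weight c u * D" using weight_pos[OF u] D by simp
    fix x' y' assume "x' \<in> JJ u" "y' \<in> JJ u"
    then obtain x y where xy: "x \<in> J" "y \<in> J" "x' = psi_comp S \<omega> u 0 x" "y' = psi_comp S \<omega> u 0 y"
      using nonautonomous_structureD(2)[OF nas u] by blast
    have lip: "norm (S j (u ! (j - 1)) x - S j (u ! (j - 1)) y) \<le> c j (u ! (j - 1)) * norm (x - y)"
      if j: "1 \<le> j" "j \<le> k" and "x \<in> psi_comp S \<omega> u j ` J" "y \<in> psi_comp S \<omega> u j ` J" for j x y
    \<comment> \<open>The map of level \<open>k\<close> is applied first, to points of
      \<open>J\<close> itself; the outer maps are governed by
      \<open>lipschitz_along\<close>.\<close>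
    proof (cases "j = k")
      case True
      then have "x \<in> J" "y \<in> J" using that length_words[OF u] by (auto simp: psi_comp_def)
      then show ?thesis using lipschitz words_nth[OF u j] j(1) by blast
    next
      case False
      then show ?thesis using that lipschitz_along[OF u] by simp
    qed
    have "norm (x' - y') \<le> weight c u * norm (x - y)"
      unfolding xy(3,4) using c xy(1,2) by (intro psi_comp_lipschitz[OF u, where J = J]) (simp_all only: lip less_imp_le)
    also have "norm (x - y) \<le> D"
      using diameter_bounded_bound[OF compact_imp_bounded[OF J(1)] xy(1,2)] by (simp add: D_def dist_norm)
    finally show "norm (x' - y') \<le> weight c u * D" using weight_pos[OF u] by simp
  qed

  have "hausdorff_dim ?E \<le> liminf ?dim"
  \<comment> \<open>The lower limit may be infinite, so the comparison goes through its real upper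
    bounds \<open>s\<close>.\<close>
  proof (rule ereal_le_real)
    fix s assume "liminf ?dim \<le> ereal s"
    show "hausdorff_dim ?E \<le> ereal s"
    proof (rule ereal_le_epsilon2)
      fix e :: real assume "0 < e"
      define t where "t = s + e"
      have "liminf ?dim < ereal t"
        using \<open>liminf ?dim \<le> ereal s\<close> \<open>0 < e\<close> by (rule_tac le_less_trans) (auto simp: t_def)
      then have "\<exists>\<^sub>F k in sequentially. ?dim k < ereal t"
        unfolding frequently_def not_less using Liminf_bounded[of "ereal t" ?dim sequentially]
        by (auto simp: not_le[symmetric])
      then have freq: "\<exists>\<^sub>F k in sequentially. critical_exponent n c k < t" by simp
      have "hausdorff_dim ?E \<le> ereal t"
      proof (rule hausdorff_dim_le[where C = "D powr t"])
        obtain k where "1 \<le> k" "critical_exponent n c k < t"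
          using freq unfolding frequently_sequentially by blast
        then have "0 < t" using level_sum_critical_exponent(1)[of k] by simp
        then show "0 \<le> t" by simp
        fix \<delta> :: real assume "0 < \<delta>"
        have "(\<lambda>k. Max ((\<lambda>u. diameter (JJ u)) ` words n k)) \<longlonglongrightarrow> 0"
          using nas unfolding nonautonomous_structure_def by blast
        then have "\<forall>\<^sub>F k in sequentially. Max ((\<lambda>u. diameter (JJ u)) ` words n k) < \<delta>"
          using \<open>0 < \<delta>\<close> by (rule order_tendstoD)
        \<comment> \<open>The exponent is below \<open>t\<close> at infinitely many levels and the
          diameters are small at all large ones, so some level has both properties.\<close>
        with freq have "\<exists>\<^sub>F k in sequentially. critical_exponent n c k < t \<and>
            Max ((\<lambda>u. diameter (JJ u)) ` words n k) < \<delta>"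
          by (rule frequently_eventually_frequently)
        then obtain k where k: "1 \<le> k" "critical_exponent n c k < t"
            "Max ((\<lambda>u. diameter (JJ u)) ` words n k) < \<delta>"
          unfolding frequently_sequentially by blast
        have "diameter (JJ u) \<le> \<delta>" if "u \<in> words n k" for u
        proof -
          have "diameter (JJ u) \<le> Max ((\<lambda>u. diameter (JJ u)) ` words n k)"
            using that by (intro Max_ge) (auto simp: finite_words)
          with k(3) show ?thesis by linarith
        qed
        moreover have "(\<Sum>U\<in>JJ ` words n k. diameter U powr t) \<le> D powr t"
        proof -
          \<comment> \<open>Distinct words may give the same set, hence only an inequality.\<close>
          have "(\<Sum>U\<in>JJ ` words n k. diameter U powr t) \<le> (\<Sum>u\<in>words n k. diameter (JJ u) powr t)"
            using sum_image_le[OF finite_words, where g = "\<lambda>U. diameter U powr t" and f = JJ]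
            by (simp add: o_def)
          also have "\<dots> \<le> (\<Sum>u\<in>words n k. (weight c u * D) powr t)"
            using diam bounded_JJ \<open>0 < t\<close> by (intro sum_mono powr_mono2) (auto simp: diameter_ge_0)
          also have "\<dots> = (\<Sum>u\<in>words n k. weight c u powr t * D powr t)"
            using D by (intro sum.cong) (auto simp: powr_mult weight_pos less_imp_le)
          also have "\<dots> = level_sum n c k t * D powr t"
            by (simp flip: sum_distrib_right add: sum_weight_words)
          also have "\<dots> \<le> 1 * D powr t"
            using level_sum_le_1[OF k(1,2)] by (intro mult_right_mono) auto
          finally show ?thesis by simp
        qed
        ultimately show "\<exists>F. finite F \<and> ?E \<subseteq> \<Union>F \<and> (\<forall>U\<in>F. bounded U \<and> diameter U \<le> \<delta>) \<and>
            (\<Sum>U\<in>F. diameter U powr t) \<le> D powr t"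
          using attractor_subset_level[OF k(1), of n JJ] bounded_JJ
          by (intro exI[of _ "JJ ` words n k"]) (auto simp: finite_words)
      qed
      then show "hausdorff_dim ?E \<le> ereal s + ereal e" by (simp add: t_def)
    qed
  qed
  moreover have "upper_box_dim ?E \<le> limsup ?dim"
    if Inf: "0 < Inf {c k j |k j. 1 \<le> k \<and> 1 \<le> j \<and> j \<le> n k}"
  proof (rule ereal_le_real)
    define a where "a = Inf {c k j |k j. 1 \<le> k \<and> 1 \<le> j \<and> j \<le> n k}"
    have a: "0 < a" using Inf by (simp add: a_def)
    have a_le: "a \<le> c k i" if "1 \<le> k" "i \<in> {1..n k}" for k i
      unfolding a_def
    proof (rule cInf_lower)
      show "bdd_below {c k j |k j. 1 \<le> k \<and> 1 \<le> j \<and> j \<le> n k}"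
        using c by (intro bdd_belowI[of _ 0]) (force intro: less_imp_le)
    qed (use that in auto)
    fix s assume "limsup ?dim \<le> ereal s"
    show "upper_box_dim ?E \<le> ereal s"
    proof (rule ereal_le_epsilon2)
      fix e :: real assume "0 < e"
      define t where "t = s + e"
      have "limsup ?dim < ereal t"
        using \<open>limsup ?dim \<le> ereal s\<close> \<open>0 < e\<close> by (rule_tac le_less_trans) (auto simp: t_def)
      then have "\<forall>\<^sub>F k in sequentially. ?dim k < ereal t" by (rule Limsup_lessD)
      then obtain K0 where K0: "\<And>k. K0 \<le> k \<Longrightarrow> critical_exponent n c k < t"
        by (auto simp: eventually_sequentially)
      \<comment> \<open>The successor keeps all levels considered at least 1, where the critical
        exponent is known to be a root.\<close>
      define K where "K = Suc K0"
      have K: "level_sum n c k t \<le> 1" if "K \<le> k" for k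
        using that K0[of k] by (intro level_sum_le_1) (auto simp: K_def)
      have t: "0 < t" using level_sum_critical_exponent(1)[of K] K0[of K] by (simp add: K_def)
      have "\<forall>\<^sub>F \<delta> in at_right 0. \<delta> \<in> {0<..<D * min 1 (a ^ K)}"
        using a D by (intro eventually_at_right_real) simp
      then have "\<forall>\<^sub>F \<delta> in at_right 0. real (box_count \<delta> ?E) \<le> (a / D) powr (- t) * \<delta> powr (- t)"
      proof eventually_elim
        case (elim \<delta>)
        then have \<delta>: "0 < \<delta>" "\<delta> / D < min 1 (a ^ K)"
          using D by (simp_all add: pos_divide_less_eq mult.commute del: min_less_iff_conj)
        \<comment> \<open>Words are stopped at the rescaled value, so that weight at most \<delta>'
          gives diameter at most \<open>\<delta>' * D = \<delta>\<close>. The range of \<delta> was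
          chosen so that \<delta>' is below both 1 and \<open>a ^ K\<close>.\<close>
        define \<delta>' where "\<delta>' = \<delta> / D"
        have \<delta>': "0 < \<delta>'" "\<delta>' < 1" "\<delta>' < a ^ K"
          using \<delta> D by (simp_all add: \<delta>'_def)
        obtain W M where W: "finite W" "real (card W) \<le> (a * \<delta>') powr (- t)"
            "\<forall>u\<in>W. u \<in> all_words n \<and> weight c u \<le> \<delta>'" "1 \<le> M"
            "\<forall>u\<in>words n M. \<exists>j\<le>M. take j u \<in> W"
          using exists_cut[OF a a_le t K \<delta>'] .
        have "box_count \<delta> ?E \<le> card (JJ ` W)"
        proof (rule box_count_le_card)
          show "finite (JJ ` W)" using W(1) by simp
          show "?E \<subseteq> \<Union>(JJ ` W)"
          proof
            fix x assume "x \<in> ?E"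
            then obtain v where v: "v \<in> words n M" "x \<in> JJ v"
              using attractor_subset_level[OF W(4), of n JJ] by blast
            then obtain j where "j \<le> M" "take j v \<in> W" using W(5) by blast
            then show "x \<in> \<Union>(JJ ` W)"
              using nonautonomous_structure_nested[OF nas v(1)] v(2) by blast
          qed
          fix U assume "U \<in> JJ ` W"
          then obtain u k where u: "U = JJ u" "u \<in> words n k" "weight c u \<le> \<delta>'"
            using W(3) by (auto simp: all_words_def)
          have "diameter U \<le> weight c u * D" using diam[OF u(2)] u(1) by simp
          also have "\<dots> \<le> \<delta>' * D" using u(3) D by (intro mult_right_mono) auto
          also have "\<dots> = \<delta>" using D by (simp add: \<delta>'_def)
          finally show "bounded U \<and> diameter U \<le> \<delta>" using bounded_JJ[OF u(2)] u(1) by simp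
        qed
        also have "\<dots> \<le> card W" using W(1) by (rule card_image_le)
        finally have "real (box_count \<delta> ?E) \<le> (a * \<delta>') powr (- t)" using W(2) by simp
        also have "a * \<delta>' = (a / D) * \<delta>" by (simp add: \<delta>'_def)
        also have "\<dots> powr (- t) = (a / D) powr (- t) * \<delta> powr (- t)"
          by (rule powr_mult)
        finally show ?case .
      qed
      then have "upper_box_dim ?E \<le> ereal t" using t by (intro upper_box_dim_le) auto
      then show "upper_box_dim ?E \<le> ereal s + ereal e" by (simp add: t_def)
    qed
  qed
  ultimately show ?thesis
    using hausdorff_dim_le_DIM[OF bounded_E] upper_box_dim_le_DIM[OF bounded_E] by auto
qed

end
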